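(* Assume Dickson's prime $k$-tuples conjecture: for every $k\ge1$ and all integers $a_1,\dots,a_k\ge1$ and $b_1,\dots,b_k$ such that there is no prime $\ell$ dividing $\prod_{i=1}^k(a_it+b_i)$ for every integer $t$, there are infinitely many positive integers $t$ for which $a_1t+b_1,\dots,a_kt+b_k$ are all prime. Then for every fixed $\varepsilon>0$ there are infinitely many triples $(m,n,x)$ with $m\ne n$ positive integers and $x$ a nonzero real number such that $\Phi_m(x)=\Phi_n(x)$ and the inequality $\frac12<|x|<2-\varepsilon$ fails.
   Context: For a positive integer $n$, $\Phi_n$ denotes the $n$-th cyclotomic polynomial, $\Phi_n(x)=\prod_{1\le a\le n,\ \gcd(a,n)=1}(x-\zeta_n^a)$, where $\zeta_n$ is a primitive $n$-th root of unity. *)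

theory Defs
  imports "HOL-Analysis.Analysis" "HOL-Computational_Algebra.Computational_Algebra"
begin

text \<open>The primitive root of unity is the standard one, \<open>cis (2 * pi / n)\<close>, so the polynomial has
  complex coefficients; at a real argument \<open>x\<close> its value is \<open>poly (cyclotomic n) (of_real x)\<close>.\<close>

definition cyclotomic :: "nat \<Rightarrow> complex poly" where
  "cyclotomic n = (\<Prod>a | 1 \<le> a \<and> a \<le> n \<and> coprime a n. [:- (cis (2 * pi / real n) ^ a), 1:])"

text \<open>Primality of an element of \<open>int\<close> entails positivity.\<close>

definition Dickson_conjecture :: bool where
  "Dickson_conjecture \<longleftrightarrow>
    (\<forall>k\<ge>1. \<forall>a b :: nat \<Rightarrow> int.
      (\<forall>i\<in>{1..k}. a i \<ge> 1) \<longrightarrow>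
      \<not> (\<exists>l::int. prime l \<and> (\<forall>t::int. l dvd (\<Prod>i=1..k. a i * t + b i))) \<longrightarrow>
      infinite {t::int. t > 0 \<and> (\<forall>i\<in>{1..k}. prime (a i * t + b i))})"

end

(* Take primes p, q, r with p + q + r = q r, so that deg Phi_{q r} = deg Phi_p + 2.  For fixed x > 1,
   Phi_{q r}(x) / Phi_p(x) tends to (x - 1)^2 as q and r grow, and the limit is 1 at x = 2: on an
   interval [c, 2] with 1 < c < 2 the difference changes sign as soon as q is large.  For fixed q, Dickson's
   conjecture for t and (q - 1) t - q yields infinitely many such r = t; there is no local
   obstruction because t = 1 gives the product -1. *)
theory Submission
  imports Defs
begin

text \<open>\<open>X^n - 1\<close> is monic and has no root in common with its derivative
  \<open>n X^(n-1)\<close>, whose only possible root is 0; hence it splits into distinct linear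
  factors over the roots of unity. The exponents run over \<open>1..n\<close> to match the indices
  in \<open>cyclotomic\<close>.\<close>

lemma prod_diff_roots_unity:
  fixes z :: complex
  assumes "n > 0"
  shows "(\<Prod>a=1..n. z - cis (2 * pi / real n) ^ a) = z ^ n - 1"
proof -
  define P :: "complex poly" where "P = monom 1 n - 1"
  have poly_P: "poly P w = w ^ n - 1" for w
    by (simp add: P_def poly_monom)
  have "coeff P n = 1"
    using assms by (simp add: P_def)
  moreover have "degree P \<le> n"
    unfolding P_def by (rule degree_diff_le) (simp_all add: degree_monom_le)
  ultimately have lead: "lead_coeff P = 1"
    using le_degree[of P n] by simp
  have "rsquarefree P"
    unfolding rsquarefree_roots
  proof safe
    fix w assume w: "poly P w = 0" "poly (pderiv P) w = 0"
    have "of_nat n * w ^ (n - 1) = 0"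
      using w(2) assms by (simp add: P_def pderiv_diff pderiv_monom poly_monom)
    then have "w = 0"
      using assms by simp
    then show False
      using w(1) assms by (simp add: poly_P zero_power)
  qed
  then have "P = (\<Prod>w | poly P w = 0. [:- w, 1:])"
    using complex_poly_decompose_rsquarefree[of P] lead by simp
  then have "poly P z = poly (\<Prod>w | poly P w = 0. [:- w, 1:]) z"
    by (rule arg_cong)
  also have "\<dots> = (\<Prod>w | w ^ n = 1. z - w)"
    by (simp add: poly_prod poly_P)
  also have "\<dots> = (\<Prod>k<n. z - cis (2 * pi * real k / real n))"
    by (rule prod.reindex_bij_betw[OF Complex.bij_betw_roots_unity[OF assms], symmetric])
  also have "\<dots> = (\<Prod>k<n. z - cis (2 * pi / real n) ^ k)"
    by (intro prod.cong) (auto simp: Complex.DeMoivre mult_ac)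
  \<comment> \<open>The exponents 0 and \<open>n\<close> both give the root 1, so one may replace
    the other.\<close>
  also have "\<dots> = (\<Prod>k\<in>insert 0 {1..<n}. z - cis (2 * pi / real n) ^ k)"
    using assms by (intro prod.cong) auto
  also have "\<dots> = (\<Prod>k\<in>insert n {1..<n}. z - cis (2 * pi / real n) ^ k)"
    using assms by (simp add: Complex.DeMoivre)
  also have "insert n {1..<n} = {1..n}"
    using assms by auto
  finally show ?thesis
    by (simp add: poly_P)
qed

lemma poly_cyclotomic:
  "poly (cyclotomic n) z = (\<Prod>a | 1 \<le> a \<and> a \<le> n \<and> coprime a n. z - cis (2 * pi / real n) ^ a)"
  by (simp add: cyclotomic_def poly_prod)

text \<open>The \<open>d\<close>-th power of the standard root of order \<open>d * n\<close> is the
  standard root of order \<open>n\<close>. This evaluates the part of a product over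
  \<open>1..d * n\<close> that comes from the multiples of \<open>d\<close>.\<close>

lemma prod_diff_roots_unity_multiples:
  fixes z :: complex
  assumes "n > 0" "d > 0"
  shows "(\<Prod>a\<in>(\<lambda>b. d * b) ` {1..n}. z - cis (2 * pi / real (d * n)) ^ a) = z ^ n - 1"
proof -
  have "(\<Prod>a\<in>(\<lambda>b. d * b) ` {1..n}. z - cis (2 * pi / real (d * n)) ^ a)
      = (\<Prod>b=1..n. z - cis (2 * pi / real (d * n)) ^ (d * b))"
    using assms by (subst prod.reindex) (auto simp: inj_on_def)
  also have "\<dots> = (\<Prod>b=1..n. z - cis (2 * pi / real n) ^ b)"
    using assms by (intro prod.cong) (auto simp: Complex.DeMoivre)
  finally show ?thesis
    using prod_diff_roots_unity[OF assms(1)] by simp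
qed

text \<open>Among the indices \<open>1..p\<close> only \<open>p\<close> itself fails to be coprime
  to \<open>p\<close>, and its factor is \<open>z - 1\<close>.\<close>

lemma poly_cyclotomic_prime:
  assumes "prime p"
  shows "poly (cyclotomic p) z * (z - 1) = z ^ p - 1"
proof -
  have p: "p > 1"
    using assms by (rule prime_gt_1_nat)
  have "{1..p} = insert p {a. 1 \<le> a \<and> a \<le> p \<and> coprime a p}"
    using p assms
    by (auto simp: coprime_commute[of _ p] prime_imp_coprime_nat
        dest: dvd_imp_le intro!: prime_imp_coprime)
  moreover have "\<not> coprime p p"
    using p by simp
  ultimately have "(\<Prod>a=1..p. z - cis (2 * pi / real p) ^ a)
      = (z - cis (2 * pi / real p) ^ p) * poly (cyclotomic p) z"
    by (simp add: poly_cyclotomic)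
  also have "cis (2 * pi / real p) ^ p = 1"
    using p by (simp add: Complex.DeMoivre)
  finally show ?thesis
    using prod_diff_roots_unity[of p z] p by (simp add: mult.commute)
qed

text \<open>Inclusion-exclusion on the indices \<open>1..q * r\<close>: the multiples of
  \<open>q\<close> contribute \<open>z ^ r - 1\<close>, those of \<open>r\<close> contribute
  \<open>z ^ q - 1\<close>, and the two sets overlap only in \<open>q * r\<close>, whose factor is
  \<open>z - 1\<close>.\<close>

lemma poly_cyclotomic_prime_mult_prime:
  assumes "prime q" "prime r" "q \<noteq> r"
  shows "poly (cyclotomic (q * r)) z * ((z ^ q - 1) * (z ^ r - 1)) = (z ^ (q * r) - 1) * (z - 1)"
proof -
  have q: "q > 1" and r: "r > 1"
    using assms prime_gt_1_nat by auto
  define f where "f a = z - cis (2 * pi / real (q * r)) ^ a" for a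
  define A where "A = (\<lambda>b. q * b) ` {1..r}"
  define B where "B = (\<lambda>b. r * b) ` {1..q}"
  define C where "C = {a. 1 \<le> a \<and> a \<le> q * r \<and> coprime a (q * r)}"
  have coprime_iff: "coprime a (q * r) \<longleftrightarrow> \<not> q dvd a \<and> \<not> r dvd a" for a
    using assms q r
    by (metis coprime_commute coprime_mult_right_iff prime_imp_coprime coprime_absorb_left
        not_prime_unit)
  have A: "A = {a. 1 \<le> a \<and> a \<le> q * r \<and> q dvd a}"
    using q by (auto simp: A_def elim!: dvdE)
  have B: "B = {a. 1 \<le> a \<and> a \<le> q * r \<and> r dvd a}"
    using r by (auto simp: B_def mult.commute[of q] elim!: dvdE)
  have "coprime q r"
    using assms by (simp add: primes_coprime)
  then have "a = q * r" if "a \<in> A \<inter> B" for a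
    using that dvd_imp_le[OF divides_mult, of q a r] by (simp add: A B)
  moreover have "q * r \<in> A \<inter> B"
    using q r by (simp add: A B)
  ultimately have AB: "A \<inter> B = {q * r}"
    by blast
  have fin: "finite A" "finite B" "finite C"
    by (simp_all add: A_def B_def C_def)
  have un: "{1..q * r} = (A \<union> B) \<union> C" and disj: "(A \<union> B) \<inter> C = {}"
    by (auto simp: A B C_def coprime_iff simp del: coprime_mult_right_iff)
  \<comment> \<open>The overlap is multiplied in on both sides rather than divided out, so the
    identity also covers those \<open>z\<close> at which factors vanish.\<close>
  have "prod f {1..q * r} * prod f (A \<inter> B) = prod f (A \<union> B) * prod f (A \<inter> B) * prod f C"
    unfolding un by (subst prod.union_disjoint) (use fin disj in auto)
  also have "prod f (A \<union> B) * prod f (A \<inter> B) = prod f A * prod f B"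
    by (rule prod.union_inter) (use fin in auto)
  finally have "prod f {1..q * r} * f (q * r) = prod f A * prod f B * prod f C"
    unfolding AB by simp
  moreover have "prod f A = z ^ r - 1"
    unfolding f_def A_def using q r by (intro prod_diff_roots_unity_multiples) auto
  moreover have "prod f B = z ^ q - 1"
    unfolding f_def B_def mult.commute[of q r]
    using q r by (intro prod_diff_roots_unity_multiples) auto
  moreover have "prod f {1..q * r} = z ^ (q * r) - 1"
    unfolding f_def using q r by (intro prod_diff_roots_unity) auto
  moreover have "prod f C = poly (cyclotomic (q * r)) z"
    unfolding f_def C_def poly_cyclotomic ..
  moreover have "f (q * r) = z - 1"
    using q r by (simp add: f_def Complex.DeMoivre)
  ultimately show ?thesis
    by (simp add: mult_ac)
qed

text \<open>For \<open>x > 1\<close> the function \<open>h\<close> below is the difference of the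
  values at \<open>x\<close> of the polynomials for \<open>q * r\<close> and \<open>p\<close>, times
  the positive number \<open>(x - 1) * (x ^ q - 1) * (x ^ r - 1)\<close>. The intermediate value
  theorem applied to \<open>h\<close> on \<open>[c, 2]\<close> gives the coincidence.\<close>

lemma cyclotomic_coincidence:
  fixes c :: real
  assumes pr: "prime p" "prime q" "prime r" "q \<noteq> r" and pqr: "p + q + r = q * r"
    and c: "1 < c" "c < 2"
    and less: "(c - 1)\<^sup>2 < (1 - (1 / c) ^ p) * (1 - (1 / c) ^ q) * (1 - (1 / c) ^ r)"
  shows "\<exists>x. c \<le> x \<and> x \<le> 2 \<and>
    poly (cyclotomic p) (of_real x) = poly (cyclotomic (q * r)) (of_real x)"
proof -
  have pos: "p > 0" "q > 0" "r > 0"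
    using pr prime_gt_0_nat by auto
  have gt1: "x ^ p > 1" "x ^ q > 1" "x ^ r > 1" if "x > 1" for x :: real
    using that pos by (simp_all add: one_less_power)
  define h :: "real \<Rightarrow> real" where
    "h x = (x ^ (q * r) - 1) * (x - 1)\<^sup>2 - (x ^ p - 1) * (x ^ q - 1) * (x ^ r - 1)" for x
  have "h c \<le> 0"
  proof -
    \<comment> \<open>As \<open>p + q + r = q * r\<close>, the power \<open>c ^ (q * r)\<close>
      splits into \<open>c ^ p * c ^ q * c ^ r\<close>, one power for each factor in
      \<open>less\<close>.\<close>
    have "(c ^ (q * r) - 1) * (c - 1)\<^sup>2 \<le> c ^ (q * r) * (c - 1)\<^sup>2"
      by (simp add: mult_right_mono)
    also have "\<dots> \<le> c ^ (q * r) * ((1 - (1 / c) ^ p) * (1 - (1 / c) ^ q) * (1 - (1 / c) ^ r))"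
      using less c by (intro mult_left_mono) auto
    also have "\<dots> = (c ^ p * (1 - (1 / c) ^ p)) * (c ^ q * (1 - (1 / c) ^ q))
        * (c ^ r * (1 - (1 / c) ^ r))"
      by (simp add: pqr[symmetric] power_add mult_ac)
    also have "\<dots> = (c ^ p - 1) * (c ^ q - 1) * (c ^ r - 1)"
      using c by (simp add: right_diff_distrib power_divide)
    finally show ?thesis
      by (simp add: h_def)
  qed
  moreover have "h 2 \<ge> 0"
  proof -
    \<comment> \<open>At \<open>x = 2\<close> the factor \<open>(x - 1)^2\<close> is 1, so it
      remains to compare \<open>2 ^ (p + q + r) - 1\<close> with the product of the three factors
      \<open>2 ^ k - 1\<close>.\<close>
    have expand: "(a - 1) * (b - 1) * (d - 1) \<le> a * b * d - 1"
      if "a \<ge> 1" "b \<ge> 1" "d \<ge> 1" for a b d :: real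
    proof -
      have "(a - 1) * (b - 1) \<le> a * b - 1"
        using that by (simp add: algebra_simps)
      then have "(a - 1) * (b - 1) * (d - 1) \<le> (a * b - 1) * (d - 1)"
        using that by (intro mult_right_mono) auto
      also have "\<dots> \<le> a * b * d - 1"
        using that mult_mono[of 1 a 1 b] by (simp add: algebra_simps)
      finally show ?thesis .
    qed
    have "(2 ^ p - 1) * (2 ^ q - 1) * (2 ^ r - 1) \<le> 2 ^ p * 2 ^ q * 2 ^ r - (1 :: real)"
      by (rule expand) simp_all
    then show ?thesis
      by (simp add: h_def pqr[symmetric] power_add)
  qed
  moreover have "continuous_on {c..2} h"
    unfolding h_def by (intro continuous_intros)
  ultimately obtain x where x: "c \<le> x" "x \<le> 2" "h x = 0"
    using IVT'[of h c 0 2] c by auto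
  have x1: "x > 1"
    using x c by simp
  let ?z = "complex_of_real x"
  have "?z ^ k \<noteq> 1" if "x ^ k > 1" for k
    using that by (metis of_real_power of_real_eq_1_iff less_irrefl)
  then have nz: "?z - 1 \<noteq> 0" "?z ^ q - 1 \<noteq> 0" "?z ^ r - 1 \<noteq> 0"
    using gt1[OF x1] x1 by auto
  have "(?z ^ (q * r) - 1) * (?z - 1)\<^sup>2 - (?z ^ p - 1) * (?z ^ q - 1) * (?z ^ r - 1) = 0"
    using arg_cong[OF x(3), of complex_of_real] by (simp add: h_def)
  \<comment> \<open>By the two product formulas the left side is
    \<open>(?z ^ p - 1) * (?z ^ q - 1) * (?z ^ r - 1)\<close> and the right side is
    \<open>(?z ^ (q * r) - 1) * (?z - 1)^2\<close>.\<close>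
  then have "(?z - 1) * ((?z ^ q - 1) * (?z ^ r - 1)) * poly (cyclotomic p) ?z
      = (?z - 1) * ((?z ^ q - 1) * (?z ^ r - 1)) * poly (cyclotomic (q * r)) ?z"
    using poly_cyclotomic_prime[OF pr(1), of ?z]
      poly_cyclotomic_prime_mult_prime[OF pr(2-4), of ?z]
    by (simp add: power2_eq_square mult_ac)
  then show ?thesis
    using nz x by auto
qed

text \<open>The second linear form is the value of \<open>p\<close> that
  \<open>p + q + r = q * r\<close> forces when \<open>r = t\<close>.\<close>

lemma Dickson_infinite_prime_pairs:
  fixes q :: int
  assumes "Dickson_conjecture" "q \<ge> 2"
  shows "infinite {t. t > 0 \<and> prime t \<and> prime ((q - 1) * t - q)}"
proof -
  define a b :: "nat \<Rightarrow> int"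
    where "a i = (if i = 1 then 1 else q - 1)" and "b i = (if i = 1 then 0 else - q)" for i
  have two: "{1..2} = {1, 2 :: nat}"
    by auto
  have "\<not> (\<exists>l::int. prime l \<and> (\<forall>t::int. l dvd (\<Prod>i=1..2. a i * t + b i)))"
  proof
    assume "\<exists>l::int. prime l \<and> (\<forall>t::int. l dvd (\<Prod>i=1..2. a i * t + b i))"
    then obtain l :: int where "prime l" "l dvd (\<Prod>i=1..2. a i * 1 + b i)"
      by blast
    then have "l > 1" "\<bar>l\<bar> = 1"
      unfolding two by (simp_all add: a_def b_def prime_gt_1_int)
    then show False
      by simp
  qed
  moreover have "\<forall>i\<in>{1..2}. a i \<ge> 1"
    using assms(2) by (simp add: a_def)
  ultimately have "infinite {t::int. t > 0 \<and> (\<forall>i\<in>{1..2}. prime (a i * t + b i))}"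
    using assms(1)[unfolded Dickson_conjecture_def, rule_format, of 2 a b] by simp
  then show ?thesis
    unfolding two by (simp add: a_def b_def)
qed

theorem mainTheorem3:
  fixes \<epsilon> :: real
  assumes "Dickson_conjecture" and "\<epsilon> > 0"
  shows "infinite {(m :: nat, n :: nat, x :: real).
    m > 0 \<and> n > 0 \<and> m \<noteq> n \<and> x \<noteq> 0 \<and>
    poly (cyclotomic m) (of_real x) = poly (cyclotomic n) (of_real x) \<and>
    \<not> (1 / 2 < \<bar>x\<bar> \<and> \<bar>x\<bar> < 2 - \<epsilon>)}"
    (is "infinite ?S")
proof
  assume fin: "finite ?S"
  \<comment> \<open>The cap 1/2 keeps \<open>c\<close> at least 3/2, hence above 1, while
    \<open>c \<ge> 2 - \<epsilon>\<close> makes every \<open>x \<ge> c\<close> violate the required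
    upper bound.\<close>
  define c where "c = 2 - min \<epsilon> (1 / 2)"
  have c: "1 < c" "c < 2" "c \<ge> 2 - \<epsilon>"
    using assms(2) by (auto simp: c_def min_def)
  \<comment> \<open>The cube bounds from below the product of the three factors with exponents
    \<open>p\<close>, \<open>q\<close>, \<open>r\<close> once all of these are at least
    \<open>n\<close>; its limit 1 exceeds \<open>(c - 1)^2\<close> because
    \<open>c < 2\<close>.\<close>
  have "(\<lambda>n. (1 - (1 / c) ^ n) ^ 3) \<longlonglongrightarrow> (1 - 0) ^ 3"
    using c by (intro tendsto_intros LIMSEQ_power_zero) auto
  moreover have "(c - 1)\<^sup>2 < (1 - 0) ^ 3"
    using c by (simp add: power_less_one_iff)
  ultimately have "\<forall>\<^sub>F n in sequentially. (c - 1)\<^sup>2 < (1 - (1 / c) ^ n) ^ 3"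
    by (rule order_tendstoD)
  then obtain N where N: "\<And>n. n \<ge> N \<Longrightarrow> (c - 1)\<^sup>2 < (1 - (1 / c) ^ n) ^ 3"
    unfolding eventually_sequentially by blast
  obtain q :: nat where q: "prime q" "q > max N 3"
    using bigger_prime by blast
  define T where "T = {t::int. t > 0 \<and> prime t \<and> prime ((int q - 1) * t - int q)}"
  \<comment> \<open>Restricting to \<open>t > q\<close> ensures \<open>r \<noteq> q\<close> and
    discards only finitely many \<open>t\<close>, since all elements of \<open>T\<close> are
    positive.\<close>
  have "infinite (T - {..int q})"
  proof -
    have "T - {..int q} = T - {0..int q}"
      by (auto simp: T_def)
    moreover have "infinite T"
      unfolding T_def using assms(1) q by (intro Dickson_infinite_prime_pairs) auto
    ultimately show ?thesis
      by (simp add: Diff_infinite_finite)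
  qed
  \<comment> \<open>The triples are told apart by their second entry \<open>q * r\<close>: distinct
    \<open>t\<close> give distinct entries, whatever \<open>x\<close> is.\<close>
  moreover have "(\<lambda>t. q * nat t) ` (T - {..int q}) \<subseteq> (\<lambda>(m, n, x). n) ` ?S"
  proof
    fix n assume "n \<in> (\<lambda>t. q * nat t) ` (T - {..int q})"
    then obtain t where t: "t \<in> T" "t > int q" "n = q * nat t"
      by (elim imageE DiffE) (simp add: not_le)
    define r where "r = nat t"
    have tr: "t = int r"
      using t q by (simp add: r_def)
    have r: "prime r" "r > q" "prime (int ((q - 1) * r) - int q)"
      using t q by (auto simp: T_def tr of_nat_diff)
    have "q * r = r + (q - 1) * r"
      using q by (cases q) auto
    \<comment> \<open>From \<open>q - 1 \<ge> 2\<close> and \<open>r > q\<close>. This makes the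
      natural-number subtraction defining \<open>p\<close> exact and yields
      \<open>p \<ge> q\<close>.\<close>
    moreover have "2 * q \<le> (q - 1) * r"
      using q r by (intro mult_le_mono) auto
    moreover define p where "p = (q - 1) * r - q"
    ultimately have pqr: "p + q + r = q * r" and "p \<ge> q"
      by auto
    have "int p = int ((q - 1) * r) - int q"
      using \<open>2 * q \<le> (q - 1) * r\<close> by (simp only: p_def of_nat_diff)
    then have "prime p"
      using r(3) by (metis prime_nat_int_transfer)
    have mono: "1 - (1 / c) ^ q \<le> 1 - (1 / c) ^ k" if "k \<ge> q" for k
      using that c by (simp add: power_decreasing)
    have nonneg: "0 \<le> 1 - (1 / c) ^ k" for k
      using c by (simp add: power_le_one)
    have "(c - 1)\<^sup>2 < (1 - (1 / c) ^ q) * (1 - (1 / c) ^ q) * (1 - (1 / c) ^ q)"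
      using N[of q] q by (simp add: power3_eq_cube)
    also have "\<dots> \<le> (1 - (1 / c) ^ p) * (1 - (1 / c) ^ q) * (1 - (1 / c) ^ r)"
      using \<open>p \<ge> q\<close> r by (intro mult_mono mono nonneg mult_nonneg_nonneg) auto
    finally obtain x where x: "c \<le> x" "x \<le> 2"
      "poly (cyclotomic p) (of_real x) = poly (cyclotomic (q * r)) (of_real x)"
      using cyclotomic_coincidence[of p q r c] \<open>prime p\<close> q r pqr c by auto
    have "p \<noteq> q * r"
      using pqr q by auto
    then have "(p, q * r, x) \<in> ?S"
      using x c q r \<open>prime p\<close> prime_gt_0_nat by auto
    then show "n \<in> (\<lambda>(m, n, x). n) ` ?S"
      unfolding t(3) r_def[symmetric] by force
  qed
  then have "finite ((\<lambda>t. q * nat t) ` (T - {..int q}))"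
    using fin by (meson finite_imageI finite_subset)
  moreover have "inj_on (\<lambda>t. q * nat t) (T - {..int q})"
    using q by (auto simp: inj_on_def T_def)
  ultimately show False
    using finite_imageD by blast
qed

end
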